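(* Let $J(x)=\tfrac12(x+x^{-1})-1$ for $x>0$. For every $x>0$, $$2\,J(\sqrt{x})\le J(x),$$ with equality if and only if $x=1$. Consequently, let $S,\mathcal{M},O$ be sets with scale maps $\iota_S:S\to\mathbb{R}_{>0}$, $\iota_M:\mathcal{M}\to\mathbb{R}_{>0}$, $\iota_O:O\to\mathbb{R}_{>0}$ such that $Y_M:=\iota_M(\mathcal{M})$ is nonempty and closed in the usual topology on $(0,\infty)$, and let $c_{\mathcal{R}_1}(s,m)=J(\iota_S(s)/\iota_M(m))$, $c_{\mathcal{R}_2}(m,o)=J(\iota_M(m)/\iota_O(o))$, $c_{\mathcal{R}}(s,o)=J(\iota_S(s)/\iota_O(o))$, and $c_{\mathcal{R}_2\circ\mathcal{R}_1}(s,o)=\inf_{m\in\mathcal{M}}[c_{\mathcal{R}_1}(s,m)+c_{\mathcal{R}_2}(m,o)]$. If $s\in S$ and $o\in O$ are such that $\sqrt{\iota_S(s)\,\iota_O(o)}\in Y_M$, then $$c_{\mathcal{R}_2\circ\mathcal{R}_1}(s,o)\le c_{\mathcal{R}}(s,o),$$ with equality if and only if $\iota_S(s)=\iota_O(o)$. *)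

theory Defs
  imports "HOL-Analysis.Analysis"
begin

text \<open>Only the values at \<open>x > 0\<close> are meaningful.\<close>

definition J :: "real \<Rightarrow> real" where
  "J x = 1 / 2 * (x + inverse x) - 1"

definition ratio_cost :: "('a \<Rightarrow> real) \<Rightarrow> ('b \<Rightarrow> real) \<Rightarrow> 'a \<Rightarrow> 'b \<Rightarrow> real" where
  "ratio_cost \<iota>A \<iota>B a b = J (\<iota>A a / \<iota>B b)"

text \<open>
  The infimum is taken in the reals, so \<open>comp_cost\<close> is meaningful only if \<open>M\<close> is nonempty and the
  summed costs are bounded below; for ratio costs of positive scale maps the latter holds because
  \<open>J\<close> is nonnegative on the positive reals.
\<close>

definition comp_cost ::
  "'m set \<Rightarrow> ('s \<Rightarrow> 'm \<Rightarrow> real) \<Rightarrow> ('m \<Rightarrow> 'o \<Rightarrow> real) \<Rightarrow> 's \<Rightarrow> 'o \<Rightarrow> real" where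
  "comp_cost M c1 c2 s z = (INF m\<in>M. c1 s m + c2 m z)"

end

theory Submission
  imports Defs
begin

text \<open>
  Since \<open>J (t\<^sup>2) = 2 * J t * (J t + 2)\<close> and \<open>J t \<ge> 0\<close> vanishes only at \<open>t = 1\<close>, the inequality and
  its equality case follow. For the composition, the mediator at the geometric mean of the two
  scales splits the ratio \<open>x\<close> into two equal factors \<open>sqrt x\<close>, at total cost \<open>2 * J (sqrt x)\<close>.
\<close>

text \<open>Putting \<open>J\<close> over the common denominator \<open>2 * x\<close> completes the
  square, so its sign and its only zero on the positive reals can be read off.\<close>

lemma J_eq_square:
  assumes "x > 0"
  shows "J x = (x - 1)\<^sup>2 / (2 * x)"
  using assms by (simp add: J_def field_simps power2_eq_square)

lemma J_nonneg:
  assumes "x > 0"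
  shows "0 \<le> J x"
  using assms by (simp add: J_eq_square)

lemma J_eq_0_iff:
  assumes "x > 0"
  shows "J x = 0 \<longleftrightarrow> x = 1"
  using assms by (simp add: J_eq_square)

text \<open>This is the double-angle formula for cosh: with t = exp u, \<open>J t + 1\<close> is
  cosh u, and cosh (2u) = 2 (cosh u)^2 - 1.\<close>

lemma J_square:
  assumes "t \<noteq> 0"
  shows "J (t\<^sup>2) = 2 * J t * (J t + 2)"
  using assms by (simp add: J_def field_simps power2_eq_square)

lemma J_sqrt:
  assumes "x > 0"
  shows "2 * J (sqrt x) \<le> J x" and "2 * J (sqrt x) = J x \<longleftrightarrow> x = 1"
proof -
  define t where "t = sqrt x"
  have t: "t > 0" "x = t\<^sup>2"
    using assms by (simp_all add: t_def)
  have nonneg: "0 \<le> J t"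
    using t by (intro J_nonneg)
  \<comment> \<open>The factor \<open>J t + 1\<close> is at least 1, so the difference has the sign
    of \<open>J t\<close> and vanishes exactly when \<open>J t\<close> does.\<close>
  have diff: "J x - 2 * J t = 2 * J t * (J t + 1)"
    using t by (simp add: J_square algebra_simps)
  have "0 \<le> 2 * J t * (J t + 1)"
    using nonneg by simp
  then show "2 * J (sqrt x) \<le> J x"
    using diff by (simp add: t_def)
  have "2 * J t = J x \<longleftrightarrow> 2 * J t * (J t + 1) = 0"
    using diff by linarith
  also have "\<dots> \<longleftrightarrow> J t = 0"
    using nonneg by auto
  \<comment> \<open>The other root t = -1 of t^2 = 1 is excluded by \<open>t > 0\<close>.\<close>
  also have "\<dots> \<longleftrightarrow> x = 1"
    using t J_eq_0_iff[of t] by (simp add: power2_eq_1_iff)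
  finally show "2 * J (sqrt x) = J x \<longleftrightarrow> x = 1"
    by (simp add: t_def)
qed

lemma geometric_mean_ratio:
  assumes "a > 0" "b > 0"
  shows "a / sqrt (a * b) = sqrt (a / b)" and "sqrt (a * b) / b = sqrt (a / b)"
proof -
  have "a = sqrt a * sqrt a" "b = sqrt b * sqrt b"
    using assms by simp_all
  then show "a / sqrt (a * b) = sqrt (a / b)" "sqrt (a * b) / b = sqrt (a / b)"
    using assms by (simp_all add: real_sqrt_mult real_sqrt_divide field_simps)
qed

lemma ratio_cost_nonneg:
  assumes "\<iota>A a > 0" "\<iota>B b > 0"
  shows "0 \<le> ratio_cost \<iota>A \<iota>B a b"
  using assms by (simp add: ratio_cost_def J_nonneg)

text \<open>Nonemptiness of \<open>M\<close> matters because a lower bound of the empty family says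
  nothing about its real infimum.\<close>

lemma comp_cost_nonneg:
  assumes "M \<noteq> {}" "\<And>m. m \<in> M \<Longrightarrow> 0 \<le> c1 s m + c2 m z"
  shows "0 \<le> comp_cost M c1 c2 s z"
  unfolding comp_cost_def using assms by (rule cINF_greatest)

text \<open>The bound 0 makes the family bounded below; only then does the real infimum lie below
  each member.\<close>

lemma comp_cost_le:
  assumes "m \<in> M" "\<And>m. m \<in> M \<Longrightarrow> 0 \<le> c1 s m + c2 m z"
  shows "comp_cost M c1 c2 s z \<le> c1 s m + c2 m z"
  unfolding comp_cost_def using assms by (intro cINF_lower bdd_belowI2[where m = 0])

text \<open>The infimum is never computed: an upper bound from one mediator and the lower bound 0
  settle both claims.\<close>

lemma comp_ratio_cost_geometric_mean:
  assumes s: "\<iota>S s > 0" and z: "\<iota>O z > 0" and M: "\<iota>M \<in> M \<rightarrow> {0<..}"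
    and mean: "sqrt (\<iota>S s * \<iota>O z) \<in> \<iota>M ` M"
  defines "c \<equiv> comp_cost M (ratio_cost \<iota>S \<iota>M) (ratio_cost \<iota>M \<iota>O) s z"
  shows "c \<le> ratio_cost \<iota>S \<iota>O s z" and "c = ratio_cost \<iota>S \<iota>O s z \<longleftrightarrow> \<iota>S s = \<iota>O z"
proof -
  let ?x = "\<iota>S s / \<iota>O z"
  have x: "?x > 0"
    using s z by simp
  obtain m where m: "m \<in> M" "\<iota>M m = sqrt (\<iota>S s * \<iota>O z)"
    using mean by auto
  have nonneg: "0 \<le> ratio_cost \<iota>S \<iota>M s n + ratio_cost \<iota>M \<iota>O n z" if "n \<in> M" for n
    using that s z M by (intro add_nonneg_nonneg ratio_cost_nonneg) auto
  have c_ge: "0 \<le> c"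
    unfolding c_def using m(1) nonneg by (intro comp_cost_nonneg) auto
  have "c \<le> ratio_cost \<iota>S \<iota>M s m + ratio_cost \<iota>M \<iota>O m z"
    unfolding c_def using m(1) nonneg by (rule comp_cost_le)
  also have "\<dots> = 2 * J (sqrt ?x)"
    using geometric_mean_ratio[OF s z] by (simp add: ratio_cost_def m(2))
  finally have c_le: "c \<le> 2 * J (sqrt ?x)" .
  then show le: "c \<le> ratio_cost \<iota>S \<iota>O s z"
    using J_sqrt(1)[OF x] by (simp add: ratio_cost_def)
  show "c = ratio_cost \<iota>S \<iota>O s z \<longleftrightarrow> \<iota>S s = \<iota>O z"
  proof
    assume "c = ratio_cost \<iota>S \<iota>O s z"
    \<comment> \<open>Equality squeezes the chain \<open>J ?x\<close> = \<open>c\<close> \<le>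
      \<open>2 * J (sqrt ?x)\<close> \<le> \<open>J ?x\<close>.\<close>
    then have "2 * J (sqrt ?x) = J ?x"
      using c_le J_sqrt(1)[OF x] by (simp add: ratio_cost_def)
    then show "\<iota>S s = \<iota>O z"
      using J_sqrt(2)[OF x] z by simp
  next
    assume "\<iota>S s = \<iota>O z"
    \<comment> \<open>The ratio is 1, so the direct cost is 0 and \<open>c\<close> is caught between
      0 and 0.\<close>
    then have "ratio_cost \<iota>S \<iota>O s z = 0"
      using z by (simp add: ratio_cost_def J_eq_0_iff)
    then show "c = ratio_cost \<iota>S \<iota>O s z"
      using le c_ge by simp
  qed
qed

theorem corollary5p6:
  shows "(\<forall>x::real. x > 0 \<longrightarrow>
            2 * J (sqrt x) \<le> J x \<and> (2 * J (sqrt x) = J x \<longleftrightarrow> x = 1))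
       \<and> (\<forall>(S :: 's set) (M :: 'm set) (Ob :: 'o set)
            (\<iota>S :: 's \<Rightarrow> real) (\<iota>M :: 'm \<Rightarrow> real) (\<iota>O :: 'o \<Rightarrow> real).
            \<iota>S \<in> S \<rightarrow> {0<..} \<longrightarrow> \<iota>M \<in> M \<rightarrow> {0<..} \<longrightarrow> \<iota>O \<in> Ob \<rightarrow> {0<..} \<longrightarrow>
            \<iota>M ` M \<noteq> {} \<longrightarrow> closedin (top_of_set {0<..}) (\<iota>M ` M) \<longrightarrow>
            (\<forall>s\<in>S. \<forall>z\<in>Ob. sqrt (\<iota>S s * \<iota>O z) \<in> \<iota>M ` M \<longrightarrow>
               comp_cost M (ratio_cost \<iota>S \<iota>M) (ratio_cost \<iota>M \<iota>O) s z \<le> ratio_cost \<iota>S \<iota>O s z \<and>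
               (comp_cost M (ratio_cost \<iota>S \<iota>M) (ratio_cost \<iota>M \<iota>O) s z = ratio_cost \<iota>S \<iota>O s z
                  \<longleftrightarrow> \<iota>S s = \<iota>O z)))"
proof (intro conjI allI impI ballI)
  fix x :: real
  assume "x > 0"
  then show "2 * J (sqrt x) \<le> J x" "2 * J (sqrt x) = J x \<longleftrightarrow> x = 1"
    by (rule J_sqrt)+
next
  fix S :: "'s set" and M :: "'m set" and Ob :: "'o set"
    and \<iota>S :: "'s \<Rightarrow> real" and \<iota>M :: "'m \<Rightarrow> real" and \<iota>O :: "'o \<Rightarrow> real" and s z
  assume "\<iota>S \<in> S \<rightarrow> {0<..}" and M: "\<iota>M \<in> M \<rightarrow> {0<..}" and "\<iota>O \<in> Ob \<rightarrow> {0<..}"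
    and "s \<in> S" "z \<in> Ob" and mean: "sqrt (\<iota>S s * \<iota>O z) \<in> \<iota>M ` M"
  then have pos: "\<iota>S s > 0" "\<iota>O z > 0"
    by auto
  show "comp_cost M (ratio_cost \<iota>S \<iota>M) (ratio_cost \<iota>M \<iota>O) s z \<le> ratio_cost \<iota>S \<iota>O s z"
    "comp_cost M (ratio_cost \<iota>S \<iota>M) (ratio_cost \<iota>M \<iota>O) s z = ratio_cost \<iota>S \<iota>O s z
      \<longleftrightarrow> \<iota>S s = \<iota>O z"
    using comp_ratio_cost_geometric_mean[of \<iota>S s \<iota>O z \<iota>M M, OF pos M mean] by blast+
qed

end
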